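(* Let $\ell>1$, $\ell\in\mathbb{N}$, and let $A$ be an $n\times n$ complex matrix with $\det A\neq 0$ and with Jordan representation $$A=uA_{\mathcal J}u^{-1},\qquad A_{\mathcal J}=\mathrm{diag}\{\mathcal A_1,\mathcal A_2,\ldots,\mathcal A_s\},\qquad \mathcal A_i=\mu_i I_{p_i}+\mathcal S_1,$$ where $\mathcal A_i$ is a Jordan cell of order $p_i$. Let the scalar function $f$ be defined on the spectrum of $A$ and suppose $f(\mu_i)\neq 0$ for $1\le i\le s$. For each $1\le i\le s$ let $k_i\in\{0,1,\ldots,\ell-1\}$ be an arbitrary fixed value, and put $$Q=u\,\mathrm{diag}\{\mathcal B_1,\mathcal B_2,\ldots,\mathcal B_s\}\,u^{-1},\qquad \mathcal B_i=g_{p_i}\big(f(\mathcal A_i)-f(\mu_i)I_{p_i},\,f(\mu_i),\,k_i\big),$$ where $g_p(\cdot,\mu,k)$ is the truncated Taylor polynomial of $(\lambda+\mu)^{1/\ell}$ defined in the context. Then $$Q^{\ell}=f(A),\qquad AQ=QA.$$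
   Context: $\mathcal S_1$ denotes the $p_i\times p_i$ shift matrix with ones on the first superdiagonal and zeros elsewhere; $I_p$ is the $p\times p$ identity matrix. For $\mu\in\mathbb{C}$, $\mu\ne0$, fix arbitrarily one $\ell$-th root $\xi_0$ of $\mu$. For $k\in\{0,\ldots,\ell-1\}$ set $\mu^{1/\ell}:=e^{2\pi \mathrm{i}k/\ell}\xi_0$ and $\mu^{\frac1\ell-q}:=\mu^{1/\ell}\mu^{-q}$ for $q\in\mathbb{N}$. For $p\in\mathbb{N}$ the polynomial $g_p(\lambda)=g_p(\lambda,\mu,k)$ is the sum of the first $p$ terms of the Taylor expansion at $\lambda=0$ of the branch of $(\lambda+\mu)^{1/\ell}$ that equals $\mu^{1/\ell}$ at $\lambda=0$: $$g_p(\lambda)=\mu^{1/\ell}+\tfrac1\ell\mu^{\frac1\ell-1}\lambda+\tfrac1\ell\big(\tfrac1\ell-1\big)\mu^{\frac1\ell-2}\tfrac{\lambda^2}{2}+\cdots+\tfrac1\ell\big(\tfrac1\ell-1\big)\cdots\big(\tfrac1\ell-p+2\big)\mu^{\frac1\ell-p+1}\tfrac{\lambda^{p-1}}{(p-1)!}.$$ A function $f$ is "defined on the spectrum of $A$" if, the minimal polynomial of $A$ being $\prod_i(\lambda-\lambda_i)^{d_i}$ with distinct $\lambda_i$, the value $f(\lambda_i)$ and the derivatives of $f$ at $\lambda_i$ required in the usual (Gantmacher/Hermite interpolation) definition of a function of a matrix exist; then $f(A)$ denotes the corresponding matrix function, and $f(\mathcal A_i)=\sum_{q=0}^{p_i-1}\frac{f^{(q)}(\mu_i)}{q!}\mathcal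 S_1^q$ on a Jordan cell. *)

theory Defs
  imports "HOL-Analysis.Analysis" "Jordan_Normal_Form.Jordan_Normal_Form"
begin

definition poly_mat :: "'a :: comm_ring_1 poly \<Rightarrow> 'a mat \<Rightarrow> 'a mat" where
  "poly_mat r A = mat (dim_row A) (dim_row A)
     (\<lambda>(i, j). \<Sum>q\<le>degree r. coeff r q * (A ^\<^sub>m q) $$ (i, j))"

definition minimal_poly :: "complex mat \<Rightarrow> complex poly" where
  "minimal_poly A = (THE m. lead_coeff m = 1 \<and> poly_mat m A = 0\<^sub>m (dim_row A) (dim_row A) \<and>
     (\<forall>r. r \<noteq> 0 \<and> poly_mat r A = 0\<^sub>m (dim_row A) (dim_row A) \<longrightarrow> degree m \<le> degree r))"

(* The iterated derivative (deriv ^^ q) f is total in HOL.  That the q-th derivative at z really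
   exists means: the derivative of order q - 1 exists in a neighbourhood of z and is
   differentiable at z.  Order 0 imposes nothing. *)
fun nth_deriv_exists :: "nat \<Rightarrow> (complex \<Rightarrow> complex) \<Rightarrow> complex \<Rightarrow> bool" where
  "nth_deriv_exists 0 f z = True"
| "nth_deriv_exists (Suc q) f z \<longleftrightarrow>
     (\<forall>\<^sub>F w in nhds z. nth_deriv_exists q f w) \<and> (deriv ^^ q) f field_differentiable (at z)"

(* order z (minimal_poly A) is the exponent d_i if z is the eigenvalue lambda_i,
   and 0 if z is not an eigenvalue. *)
definition defined_on_spectrum :: "(complex \<Rightarrow> complex) \<Rightarrow> complex mat \<Rightarrow> bool" where
  "defined_on_spectrum f A \<longleftrightarrow>
     (\<forall>z. \<forall>q < order z (minimal_poly A). nth_deriv_exists q f z)"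

(* Gantmacher's definition: f(A) = r(A) for any polynomial r whose values and derivatives on the
   spectrum of A are those of f.  Two such r differ by a multiple of the minimal polynomial. *)
definition mat_fun :: "(complex \<Rightarrow> complex) \<Rightarrow> complex mat \<Rightarrow> complex mat" where
  "mat_fun f A = poly_mat
     (SOME r. \<forall>z. \<forall>q < order z (minimal_poly A). poly ((pderiv ^^ q) r) z = (deriv ^^ q) f z) A"

(* The value mu^(1/l) with index k; xi0 mu is the l-th root of mu that has been fixed. *)
definition root_branch :: "nat \<Rightarrow> (complex \<Rightarrow> complex) \<Rightarrow> complex \<Rightarrow> nat \<Rightarrow> complex" where
  "root_branch l xi0 \<mu> k = exp (2 * of_real pi * \<i> * of_nat k / of_nat l) * xi0 \<mu>"

(* The coefficient (1/l)(1/l - 1)...(1/l - q + 1) / q! is the generalised binomial coefficient. *)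
definition g_poly ::
  "nat \<Rightarrow> (complex \<Rightarrow> complex) \<Rightarrow> nat \<Rightarrow> complex \<Rightarrow> nat \<Rightarrow> complex poly" where
  "g_poly l xi0 p \<mu> k =
     (\<Sum>q<p. monom (((1 / of_nat l) gchoose q) * (root_branch l xi0 \<mu> k / \<mu> ^ q)) q)"

end

theory Submission
  imports Defs
begin

text \<open>
  On a single Jordan cell \<open>J\<close> of order \<open>m\<close> with eigenvalue \<open>a\<close>, a polynomial in \<open>J\<close> is determined by
  the first \<open>m\<close> Taylor coefficients of the polynomial at \<open>a\<close>: the map \<open>r \<mapsto> r(J)\<close> is reduction
  modulo \<open>(x - a)\<^sup>m\<close> (\<open>poly_mat_jordan_block_eq_iff\<close>). So the whole statement is about polynomials
  modulo powers of \<open>x - a\<close>.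

  Let \<open>J\<^sub>i\<close> be the cell of order \<open>p\<^sub>i\<close> with eigenvalue \<open>\<mu>\<^sub>i\<close>, and let \<open>r\<close> be a Hermite
  interpolation polynomial of \<open>f\<close> on the spectrum of \<open>A\<close>, so that \<open>f(A) = r(A)\<close>.
  The minimal polynomial of \<open>A\<close> is divisible by \<open>x - \<mu>\<^sub>i\<close> to the power \<open>p\<^sub>i\<close>, and hence \<open>r\<close>
  has the Taylor coefficients of \<open>f\<close> at \<open>\<mu>\<^sub>i\<close> up to order \<open>p\<^sub>i - 1\<close>. Consequently the one
  polynomial \<open>r\<close> serves all cells: \<open>f(J\<^sub>i) = r(J\<^sub>i)\<close> for every \<open>i\<close>.

  With \<open>c = f(\<mu>\<^sub>i)\<close>, the block \<open>B\<^sub>i\<close> is therefore \<open>g(r - c)\<close> evaluated at \<open>J\<^sub>i\<close>, where \<open>g\<close> is the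
  truncated binomial series. Since \<open>g\<^sup>l \<equiv> x + c\<close> modulo \<open>x\<close> to the power \<open>p\<^sub>i\<close> (\<open>g_poly_power\<close>)
  and \<open>x - \<mu>\<^sub>i\<close> divides \<open>r - c\<close>, substituting \<open>r - c\<close> yields \<open>g(r - c)\<^sup>l \<equiv> r\<close> modulo
  \<open>x - \<mu>\<^sub>i\<close> to the power \<open>p\<^sub>i\<close>, that is, \<open>B\<^sub>i\<^sup>l = r(J\<^sub>i) = f(J\<^sub>i)\<close>
  (\<open>g_poly_jordan_block\<close>). Each \<open>B\<^sub>i\<close>, being a polynomial in \<open>J\<^sub>i\<close>, commutes with \<open>J\<^sub>i\<close>. Both facts
  pass to the block diagonal matrices and then, by conjugation with \<open>u\<close>, to \<open>Q\<close> and \<open>A\<close>. The matrix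
  \<open>Q\<close> itself need not be a polynomial in \<open>A\<close>, because cells with the same eigenvalue may use
  different branches \<open>k\<^sub>i\<close>; this is why the argument runs block by block.
\<close>

section \<open>Polynomials of a square matrix\<close>

lemma poly_mat_carrier [simp]:
  "A \<in> carrier_mat n n \<Longrightarrow> poly_mat r A \<in> carrier_mat n n"
  by (auto simp: poly_mat_def)

lemma poly_mat_dim [simp]:
  "dim_row (poly_mat r A) = dim_row A" "dim_col (poly_mat r A) = dim_row A"
  by (auto simp: poly_mat_def)

lemma pow_mat_Suc_left:
  "A \<in> carrier_mat n n \<Longrightarrow> A ^\<^sub>m Suc q = A * A ^\<^sub>m q"
proof (induction q)
  case (Suc q)
  have "A ^\<^sub>m Suc (Suc q) = A * A ^\<^sub>m q * A" using Suc by simp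
  also have "\<dots> = A * A ^\<^sub>m Suc q"
    using Suc.prems assoc_mult_mat[of A n n "A ^\<^sub>m q" n A n] by simp
  finally show ?case .
qed auto

lemma poly_mat_0: "A \<in> carrier_mat n n \<Longrightarrow> poly_mat 0 A = 0\<^sub>m n n"
  by (auto simp: poly_mat_def)

text \<open>
  Horner's recursion. It turns the laws of polynomial evaluation below into inductions on the
  polynomial, in which the matrix powers no longer appear.
\<close>
lemma poly_mat_pCons:
  fixes A :: "'a :: comm_ring_1 mat"
  assumes A: "A \<in> carrier_mat n n"
  shows "poly_mat (pCons a r) A = a \<cdot>\<^sub>m 1\<^sub>m n + A * poly_mat r A"
proof (rule eq_matI)
  fix i j assume "i < dim_row (a \<cdot>\<^sub>m 1\<^sub>m n + A * poly_mat r A)"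
    "j < dim_col (a \<cdot>\<^sub>m 1\<^sub>m n + A * poly_mat r A)"
  with A have ij: "i < n" "j < n" by auto
  have dim [simp]: "dim_row A = n" "dim_col A = n" using A by auto
  have top: "(\<Sum>q\<le>degree (pCons a r). coeff (pCons a r) q * (A ^\<^sub>m q) $$ (i, j))
      = (\<Sum>q\<le>Suc (degree r). coeff (pCons a r) q * (A ^\<^sub>m q) $$ (i, j))"
    by (cases "r = 0") (auto intro!: sum.mono_neutral_left simp: coeff_eq_0)
  have pow: "(A ^\<^sub>m Suc q) $$ (i, j) = (\<Sum>m<n. A $$ (i, m) * (A ^\<^sub>m q) $$ (m, j))" for q
    using ij A unfolding pow_mat_Suc_left[OF A]
    by (simp add: scalar_prod_def atLeast0LessThan del: pow_mat.simps)
  have "poly_mat (pCons a r) A $$ (i, j)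
      = (\<Sum>q\<le>Suc (degree r). coeff (pCons a r) q * (A ^\<^sub>m q) $$ (i, j))"
    using ij top by (simp add: poly_mat_def del: pow_mat.simps)
  also have "\<dots> = a * (1\<^sub>m n :: 'a mat) $$ (i, j)
      + (\<Sum>q\<le>degree r. coeff r q * (A ^\<^sub>m Suc q) $$ (i, j))"
    by (subst sum.atMost_Suc_shift) simp
  also have "(\<Sum>q\<le>degree r. coeff r q * (A ^\<^sub>m Suc q) $$ (i, j))
      = (\<Sum>m<n. A $$ (i, m) * (\<Sum>q\<le>degree r. coeff r q * (A ^\<^sub>m q) $$ (m, j)))"
    unfolding pow sum_distrib_left by (subst sum.swap) (simp add: algebra_simps)
  also have "\<dots> = (A * poly_mat r A) $$ (i, j)"
    using ij by (simp add: poly_mat_def scalar_prod_def atLeast0LessThan)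
  finally show "poly_mat (pCons a r) A $$ (i, j) = (a \<cdot>\<^sub>m 1\<^sub>m n + A * poly_mat r A) $$ (i, j)"
    using ij by simp
qed (use A in auto)

lemma poly_mat_const: "A \<in> carrier_mat n n \<Longrightarrow> poly_mat [:a:] A = a \<cdot>\<^sub>m 1\<^sub>m n"
  by (auto simp: poly_mat_pCons poly_mat_0)

lemma poly_mat_add:
  assumes A: "A \<in> carrier_mat n n"
  shows "poly_mat (r + t) A = poly_mat r A + poly_mat t A"
proof (induction r t rule: poly_induct2)
  case (pCons a r b t)
  have "A * (poly_mat r A + poly_mat t A) = A * poly_mat r A + A * poly_mat t A"
    using A by (intro mult_add_distrib_mat) auto
  then show ?case
    unfolding add_pCons poly_mat_pCons[OF A] pCons.IH
    using A by (auto intro!: eq_matI simp: algebra_simps)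
qed (use A in \<open>auto simp: poly_mat_0\<close>)

lemma poly_mat_smult:
  assumes A: "A \<in> carrier_mat n n"
  shows "poly_mat (Polynomial.smult c r) A = c \<cdot>\<^sub>m poly_mat r A"
proof (induction r)
  case (pCons a r)
  have "A * (c \<cdot>\<^sub>m poly_mat r A) = c \<cdot>\<^sub>m (A * poly_mat r A)"
    using A by (intro mult_smult_distrib) auto
  then show ?case
    unfolding smult_pCons poly_mat_pCons[OF A] pCons.IH
    using A by (auto intro!: eq_matI simp: algebra_simps)
qed (use A in \<open>auto simp: poly_mat_0\<close>)

lemma poly_mat_diff:
  assumes A: "A \<in> carrier_mat n n"
  shows "poly_mat (r - t) A = poly_mat r A - poly_mat t A"
proof -
  have "poly_mat (r - t) A = poly_mat r A + poly_mat (Polynomial.smult (-1) t) A"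
    by (simp flip: poly_mat_add[OF A])
  then show ?thesis
    unfolding poly_mat_smult[OF A] using A by (auto intro!: eq_matI)
qed

lemma poly_mat_mult:
  assumes A: "A \<in> carrier_mat n n"
  shows "poly_mat (r * t) A = poly_mat r A * poly_mat t A"
proof (induction r)
  case (pCons a r)
  let ?T = "poly_mat t A"
  have T: "?T \<in> carrier_mat n n" using A by simp
  have R: "poly_mat r A \<in> carrier_mat n n" using A by simp
  have "(a \<cdot>\<^sub>m 1\<^sub>m n + A * poly_mat r A) * ?T = (a \<cdot>\<^sub>m 1\<^sub>m n) * ?T + A * poly_mat r A * ?T"
    using A T by (intro add_mult_distrib_mat[of _ n n]) auto
  also have "(a \<cdot>\<^sub>m 1\<^sub>m n) * ?T = a \<cdot>\<^sub>m ?T"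
    using A T by (subst mult_smult_assoc_mat[of _ n n]) auto
  also have "A * poly_mat r A * ?T = A * (poly_mat r A * ?T)"
    using A R T by (rule assoc_mult_mat)
  also have "\<dots> = poly_mat (pCons 0 (r * t)) A"
    using A by (simp add: poly_mat_pCons pCons.IH) (auto intro!: eq_matI)
  finally show ?case
    using A by (simp add: poly_mat_pCons poly_mat_add poly_mat_smult)
qed (use A in \<open>auto simp: poly_mat_0\<close>)

lemma poly_mat_power:
  assumes A: "A \<in> carrier_mat n n"
  shows "poly_mat (r ^ l) A = poly_mat r A ^\<^sub>m l"
proof (induction l)
  case 0
  have "poly_mat [:1:] A = 1\<^sub>m n" using poly_mat_const[OF A, of 1] by auto
  then show ?case using A by (simp add: one_pCons)
next
  case (Suc l)
  then show ?case using A by (simp add: poly_mat_mult mult.commute[of r])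
qed

lemma poly_mat_pcompose:
  assumes A: "A \<in> carrier_mat n n"
  shows "poly_mat (pcompose g h) A = poly_mat g (poly_mat h A)"
proof (induction g)
  case (pCons a g)
  have H: "poly_mat h A \<in> carrier_mat n n" using A by simp
  show ?case
    by (simp add: pcompose_pCons poly_mat_add[OF A] poly_mat_mult[OF A] poly_mat_const[OF A]
        poly_mat_pCons[OF H] pCons.IH)
qed (use A in \<open>simp add: poly_mat_0[of _ n]\<close>)

lemma poly_mat_commute:
  assumes A: "A \<in> carrier_mat n n"
  shows "poly_mat r A * poly_mat t A = poly_mat t A * poly_mat r A"
  by (metis poly_mat_mult[OF A] mult.commute)

lemma poly_mat_X: "A \<in> carrier_mat n n \<Longrightarrow> poly_mat [:0, 1:] A = A"
  by (auto intro!: eq_matI simp: poly_mat_pCons poly_mat_0)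

text \<open>
  Conjugation is a ring homomorphism that fixes the scalar matrices, so it commutes with every
  polynomial; in the induction the inner factors \<open>v * u\<close> cancel.
\<close>
lemma poly_mat_similar:
  assumes sim: "similar_mat_wit A J u v"
  shows "poly_mat r A = u * poly_mat r J * v"
proof -
  define n where "n = dim_row A"
  note w = similar_mat_witD[OF n_def sim]
  note [simp] = w(4-7) mult_carrier_mat[of _ n n _ n]
  show ?thesis
  proof (induction r)
    case (pCons a r)
    let ?R = "poly_mat r J"
    have R [simp]: "?R \<in> carrier_mat n n" by simp
    have "u * J * v * (u * ?R * v) = u * J * (v * u) * ?R * v"
      by (simp add: assoc_mult_mat[of _ n n _ n _ n])
    also have "\<dots> = u * (J * ?R) * v"
      by (simp add: w(2) left_mult_one_mat[of _ n n] assoc_mult_mat[of _ n n _ n _ n])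
    finally have AR: "A * poly_mat r A = u * (J * ?R) * v"
      using w(3) pCons.IH by simp
    have "u * (a \<cdot>\<^sub>m 1\<^sub>m n + J * ?R) * v = (u * (a \<cdot>\<^sub>m 1\<^sub>m n) + u * (J * ?R)) * v"
      by (subst mult_add_distrib_mat[of _ n n _ n]) auto
    also have "\<dots> = u * (a \<cdot>\<^sub>m 1\<^sub>m n) * v + u * (J * ?R) * v"
      by (subst add_mult_distrib_mat[of _ n n _ _ n]) auto
    also have "u * (a \<cdot>\<^sub>m 1\<^sub>m n) * v = a \<cdot>\<^sub>m 1\<^sub>m n"
      by (subst mult_smult_distrib[of _ n n _ n], simp, simp,
          subst mult_smult_assoc_mat[of _ n n _ n], auto simp: w(1) right_mult_one_mat[of _ n n])
    finally show ?case
      by (simp add: poly_mat_pCons[of _ n] AR)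
  qed (simp add: poly_mat_0[of _ n] left_mult_zero_mat[of _ n n] right_mult_zero_mat[of _ n n])
qed

section \<open>Block diagonal matrices\<close>

lemma mult_block_diagonal:
  assumes "A \<in> carrier_mat m m" "A' \<in> carrier_mat m m" "D \<in> carrier_mat n n" "D' \<in> carrier_mat n n"
  shows "four_block_mat A (0\<^sub>m m n) (0\<^sub>m n m) D * four_block_mat A' (0\<^sub>m m n) (0\<^sub>m n m) D'
    = four_block_mat (A * A') (0\<^sub>m m n) (0\<^sub>m n m) (D * D')"
  using assms by (subst mult_four_block_mat[of _ m m _ n _ n _ _ m _ n]) auto

lemma poly_mat_block_diagonal:
  assumes A: "A \<in> carrier_mat m m" and D: "D \<in> carrier_mat n n"
  shows "poly_mat r (four_block_mat A (0\<^sub>m m n) (0\<^sub>m n m) D)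
    = four_block_mat (poly_mat r A) (0\<^sub>m m n) (0\<^sub>m n m) (poly_mat r D)"
    (is "poly_mat r ?M = _")
proof (induction r)
  case 0
  have M: "?M \<in> carrier_mat (m + n) (m + n)" using A D by auto
  show ?case
    unfolding poly_mat_0[OF M] poly_mat_0[OF A] poly_mat_0[OF D]
    by (rule eq_matI) auto
next
  case (pCons a r)
  have M: "?M \<in> carrier_mat (m + n) (m + n)" using A D by auto
  have "?M * poly_mat r ?M
      = four_block_mat (A * poly_mat r A) (0\<^sub>m m n) (0\<^sub>m n m) (D * poly_mat r D)"
    unfolding pCons.IH using A D by (intro mult_block_diagonal) auto
  then show ?case
    unfolding poly_mat_pCons[OF M] poly_mat_pCons[OF A] poly_mat_pCons[OF D]
    using A D by (auto intro!: eq_matI)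
qed

lemma diag_block_mat_carrier:
  assumes "\<And>x. x \<in> set xs \<Longrightarrow> X x \<in> carrier_mat (d x) (d x)"
  shows "diag_block_mat (map X xs) \<in> carrier_mat (sum_list (map d xs)) (sum_list (map d xs))"
  using assms by (induction xs) (auto simp: Let_def)

lemma diag_block_mat_Cons:
  assumes "\<And>y. y \<in> set (x # xs) \<Longrightarrow> X y \<in> carrier_mat (d y) (d y)"
  shows "diag_block_mat (map X (x # xs)) = four_block_mat (X x)
    (0\<^sub>m (d x) (sum_list (map d xs))) (0\<^sub>m (sum_list (map d xs)) (d x)) (diag_block_mat (map X xs))"
proof -
  have "diag_block_mat (map X xs) \<in> carrier_mat (sum_list (map d xs)) (sum_list (map d xs))"
    using assms by (intro diag_block_mat_carrier) auto
  moreover have "X x \<in> carrier_mat (d x) (d x)" using assms by auto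
  ultimately show ?thesis by (auto simp: Let_def)
qed

lemma diag_block_mat_mult:
  assumes "\<And>x. x \<in> set xs \<Longrightarrow> X x \<in> carrier_mat (d x) (d x)"
    and "\<And>x. x \<in> set xs \<Longrightarrow> Y x \<in> carrier_mat (d x) (d x)"
  shows "diag_block_mat (map X xs) * diag_block_mat (map Y xs)
    = diag_block_mat (map (\<lambda>x. X x * Y x) xs)"
  using assms
proof (induction xs)
  case (Cons x xs)
  let ?D = "\<lambda>X. four_block_mat (X x) (0\<^sub>m (d x) (sum_list (map d xs)))
    (0\<^sub>m (sum_list (map d xs)) (d x)) (diag_block_mat (map X xs))"
  have "diag_block_mat (map X (x # xs)) = ?D X" "diag_block_mat (map Y (x # xs)) = ?D Y"
    "diag_block_mat (map (\<lambda>x. X x * Y x) (x # xs)) = ?D (\<lambda>x. X x * Y x)"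
    using Cons.prems by (intro diag_block_mat_Cons; force)+
  moreover have "?D X * ?D Y = ?D (\<lambda>x. X x * Y x)"
    using Cons.prems Cons.IH
    by (subst mult_block_diagonal) (auto intro!: diag_block_mat_carrier)
  ultimately show ?case by argo
qed auto

lemma poly_mat_diag_block_mat:
  fixes X :: "'b \<Rightarrow> 'a :: comm_ring_1 mat"
  assumes "\<And>x. x \<in> set xs \<Longrightarrow> X x \<in> carrier_mat (d x) (d x)"
  shows "poly_mat r (diag_block_mat (map X xs)) = diag_block_mat (map (\<lambda>x. poly_mat r (X x)) xs)"
  using assms
proof (induction xs)
  case (Cons x xs)
  let ?D = "\<lambda>X. four_block_mat (X x) (0\<^sub>m (d x) (sum_list (map d xs)))
    (0\<^sub>m (sum_list (map d xs)) (d x)) (diag_block_mat (map X xs))"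
  have "diag_block_mat (map X (x # xs)) = ?D X"
    "diag_block_mat (map (\<lambda>x. poly_mat r (X x)) (x # xs)) = ?D (\<lambda>x. poly_mat r (X x))"
    using Cons.prems by (intro diag_block_mat_Cons; force)+
  moreover have "poly_mat r (?D X) = ?D (\<lambda>x. poly_mat r (X x))"
    using Cons.prems Cons.IH
    by (subst poly_mat_block_diagonal) (auto intro!: diag_block_mat_carrier)
  ultimately show ?case by argo
next
  case Nil
  show ?case by (auto simp: poly_mat_def)
qed

section \<open>Jordan cells and Taylor coefficients\<close>

lemma jordan_block_mult_index:
  fixes a :: "'a :: comm_ring_1"
  assumes M: "M \<in> carrier_mat m m" and ij: "i < m" "j < m"
  shows "(jordan_block m a * M) $$ (i, j)
    = a * M $$ (i, j) + (if Suc i < m then M $$ (Suc i, j) else 0)"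
proof -
  have "(jordan_block m a * M) $$ (i, j)
      = (\<Sum>q<m. (if i = q then a else if Suc i = q then 1 else 0) * M $$ (q, j))"
    using M ij by (simp add: scalar_prod_def atLeast0LessThan)
  also have "\<dots> = (\<Sum>q<m. (if q = i then a * M $$ (q, j) else 0)
      + (if q = Suc i then M $$ (q, j) else 0))"
    by (rule sum.cong) auto
  finally show ?thesis using ij by (simp add: sum.distrib)
qed

text \<open>
  \<open>r(a + S) = \<Sum>\<^sub>q c\<^sub>q S\<^sup>q\<close>, where \<open>S\<close> is the shift matrix and the \<open>c\<^sub>q\<close> are the coefficients of \<open>r(a + x)\<close>,
  the Taylor coefficients of \<open>r\<close> at \<open>a\<close>; the power \<open>S\<^sup>q\<close> has its ones on the \<open>q\<close>-th superdiagonal.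
\<close>
lemma poly_mat_jordan_block_index:
  fixes a :: "'a :: comm_ring_1"
  assumes "i < m" "j < m"
  shows "poly_mat r (jordan_block m a) $$ (i, j)
    = (if i \<le> j then coeff (pcompose r [:a, 1:]) (j - i) else 0)"
  using assms
proof (induction r arbitrary: i j)
  case (pCons b r)
  let ?J = "jordan_block m a"
  have "poly_mat (pCons b r) ?J $$ (i, j) = (if i = j then b else 0) + (?J * poly_mat r ?J) $$ (i, j)"
    using pCons.prems by (simp add: poly_mat_pCons[of _ m])
  also have "(?J * poly_mat r ?J) $$ (i, j) = a * poly_mat r ?J $$ (i, j)
      + (if Suc i < m then poly_mat r ?J $$ (Suc i, j) else 0)"
    using pCons.prems by (intro jordan_block_mult_index) auto
  finally have step: "poly_mat (pCons b r) ?J $$ (i, j) = (if i = j then b else 0)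
      + (a * poly_mat r ?J $$ (i, j) + (if Suc i < m then poly_mat r ?J $$ (Suc i, j) else 0))" .
  show ?case
  proof (cases "i < j")
    case True
    then have "j - i = Suc (j - Suc i)" "Suc i < m" using pCons.prems by auto
    then show ?thesis using True pCons.prems by (simp add: step pCons.IH pcompose_pCons)
  next
    case False
    then show ?thesis using pCons.prems by (auto simp: step pCons.IH pcompose_pCons)
  qed
qed (simp add: poly_mat_0[of _ m])

text \<open>
  The first row of the matrix already contains the \<open>m\<close> Taylor coefficients that determine it.
\<close>
lemma poly_mat_jordan_block_eq_iff:
  fixes a :: "'a :: comm_ring_1"
  shows "poly_mat r (jordan_block m a) = poly_mat t (jordan_block m a) \<longleftrightarrow>
    (\<forall>q<m. coeff (pcompose r [:a, 1:]) q = coeff (pcompose t [:a, 1:]) q)" (is "?L \<longleftrightarrow> ?R")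
proof
  assume L: ?L
  show ?R
  proof (intro allI impI)
    fix q assume "q < m"
    then show "coeff (pcompose r [:a, 1:]) q = coeff (pcompose t [:a, 1:]) q"
      using arg_cong[OF L, of "\<lambda>M. M $$ (0, q)"] by (simp add: poly_mat_jordan_block_index)
  qed
next
  assume ?R
  then show ?L by (auto intro!: eq_matI simp: poly_mat_jordan_block_index)
qed

text \<open>
  The condition that defines a matrix function compares derivatives, whereas Jordan cells see
  coefficients of the shifted polynomial. This lemma and the next one translate between the two.
\<close>
lemma higher_pderiv_pcompose_shift:
  "(pderiv ^^ q) (pcompose r [:a, 1:]) = pcompose ((pderiv ^^ q) r) [:a, 1:]"
  by (induction q) (simp_all add: pderiv_pcompose pderiv_pCons)

lemma coeff_pcompose_shift:
  fixes r :: "'a :: field_char_0 poly"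
  shows "coeff (pcompose r [:a, 1:]) q = poly ((pderiv ^^ q) r) a / fact q"
proof -
  have "poly ((pderiv ^^ q) r) a = poly ((pderiv ^^ q) (pcompose r [:a, 1:])) 0"
    by (simp add: higher_pderiv_pcompose_shift poly_pcompose)
  also have "\<dots> = coeff ((pderiv ^^ q) (pcompose r [:a, 1:])) 0"
    by (rule poly_0_coeff_0)
  also have "\<dots> = fact q * coeff (pcompose r [:a, 1:]) q"
    by (simp add: coeff_higher_pderiv pochhammer_fact)
  finally show ?thesis by simp
qed

text \<open>
  The substitution \<open>x \<mapsto> x + a\<close> is an automorphism of the polynomial ring that sends \<open>x - a\<close> to \<open>x\<close>.
\<close>
lemma linear_power_dvd_iff_coeff:
  fixes r :: "'a :: field poly"
  shows "[:- a, 1:] ^ m dvd r \<longleftrightarrow> (\<forall>q<m. coeff (pcompose r [:a, 1:]) q = 0)"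
proof -
  have hom: "pcompose x y dvd pcompose z y" if "x dvd z" for x y z :: "'a poly"
    using that by (auto simp: dvd_def pcompose_mult)
  have pow: "pcompose (x ^ m) y = pcompose x y ^ m" for x y :: "'a poly"
    by (induction m) (simp_all add: pcompose_mult pcompose_1)
  have "[:- a, 1:] ^ m dvd r \<longleftrightarrow> monom 1 m dvd pcompose r [:a, 1:]"
  proof
    assume "[:- a, 1:] ^ m dvd r"
    from hom[OF this, of "[:a, 1:]"] show "monom 1 m dvd pcompose r [:a, 1:]"
      by (simp add: pow pcompose_pCons monom_altdef)
  next
    assume "monom 1 m dvd pcompose r [:a, 1:]"
    from hom[OF this, of "[:- a, 1:]"] show "[:- a, 1:] ^ m dvd r"
      by (simp add: pow pcompose_pCons monom_altdef pcompose_assoc[symmetric])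
  qed
  then show ?thesis by (simp add: monom_1_dvd_iff')
qed

text \<open>
  Remove one linear factor \<open>x - a\<close> from \<open>M\<close>, leaving \<open>N\<close>. An interpolant for \<open>N\<close> misses exactly one
  condition for \<open>M\<close>: the coefficient at \<open>a\<close> whose index \<open>e\<close> is the order of \<open>N\<close> at \<open>a\<close>. Adding a multiple
  of \<open>N\<close> leaves all earlier conditions intact and changes that coefficient freely, because the
  coefficient of \<open>N\<close> itself there is nonzero.
\<close>
lemma hermite_interpolation:
  fixes M :: "'a :: field poly"
  assumes "M \<noteq> 0"
  shows "\<exists>r. \<forall>z. \<forall>q < order z M. coeff (pcompose r [:z, 1:]) q = c z q"
  using assms
proof (induction "degree M" arbitrary: M rule: less_induct)
  case less
  show ?case
  proof (cases "\<exists>a. poly M a = 0")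
    case False
    then show ?thesis by (intro exI[of _ 0]) (auto simp: order_0I)
  next
    case True
    then obtain a where "poly M a = 0" by auto
    then obtain N where M: "M = [:- a, 1:] * N" by (auto simp: poly_eq_0_iff_dvd)
    with less.prems have N: "N \<noteq> 0" by auto
    have "degree M = Suc (degree N)"
      unfolding M using N by (subst degree_mult_eq) auto
    then obtain r where r: "\<And>z q. q < order z N \<Longrightarrow> coeff (pcompose r [:z, 1:]) q = c z q"
      using less.hyps[of N] N by auto
    have ord: "order z M = (if z = a then Suc (order z N) else order z N)" for z
      using less.prems unfolding M by (subst order_mult) (auto simp: order_linear')
    have below: "coeff (pcompose N [:z, 1:]) q = 0" if "q < order z N" for z q
      using order_1[of z N] that unfolding linear_power_dvd_iff_coeff by auto
    define e where "e = order a N"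
    have lead: "coeff (pcompose N [:a, 1:]) e \<noteq> 0"
      using order_2[OF N, of a] below
      unfolding linear_power_dvd_iff_coeff e_def by (auto simp: less_Suc_eq)
    (* the solution of the one missing condition, which is linear in t *)
    define t where "t = (c a e - coeff (pcompose r [:a, 1:]) e) / coeff (pcompose N [:a, 1:]) e"
    have "coeff (pcompose (r + Polynomial.smult t N) [:z, 1:]) q = c z q" if "q < order z M" for z q
    proof (cases "z = a \<and> q = e")
      case True
      then show ?thesis using lead by (simp add: pcompose_add pcompose_smult t_def)
    next
      case False
      with that have "q < order z N" by (auto simp: ord e_def split: if_splits)
      then show ?thesis using r below by (simp add: pcompose_add pcompose_smult)
    qed
    then show ?thesis by blast
  qed
qed

section \<open>The minimal polynomial and matrix functions\<close>

text \<open>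
  The definite description of the minimal polynomial denotes as soon as some nonzero polynomial
  annihilates \<open>A\<close>: a monic annihilating polynomial of least degree exists, and the difference of two
  of them would annihilate \<open>A\<close> in lower degree.
\<close>
lemma minimal_poly_annihilates:
  assumes A: "A \<in> carrier_mat n n" and M: "M \<noteq> 0" "poly_mat M A = 0\<^sub>m n n"
  shows "minimal_poly A \<noteq> 0 \<and> poly_mat (minimal_poly A) A = 0\<^sub>m n n"
proof -
  have dim: "dim_row A = n" using A by auto
  let ?ann = "\<lambda>r. r \<noteq> 0 \<and> poly_mat r A = 0\<^sub>m n n"
  let ?min = "\<lambda>m. lead_coeff m = 1 \<and> poly_mat m A = 0\<^sub>m n n \<and> (\<forall>r. ?ann r \<longrightarrow> degree m \<le> degree r)"
  from M obtain m0 where m0: "?ann m0" "\<And>r. ?ann r \<Longrightarrow> degree m0 \<le> degree r"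
    using ex_has_least_nat[of ?ann M degree] by blast
  define m where "m = Polynomial.smult (inverse (lead_coeff m0)) m0"
  have "?min m"
    using m0 by (auto simp: m_def poly_mat_smult[OF A])
  moreover have "m' = m" if m': "?min m'" for m'
  proof (rule ccontr)
    assume "m' \<noteq> m"
    moreover have "poly_mat (m' - m) A = 0\<^sub>m n n"
      using m' \<open>?min m\<close> by (simp add: poly_mat_diff[OF A])
    ultimately have le: "degree m \<le> degree (m' - m)" using \<open>?min m\<close> by auto
    have deg: "degree m' = degree m"
      using m' \<open>?min m\<close> by (metis le_antisym leading_coeff_0_iff one_neq_zero)
    then have "coeff (m' - m) (degree m) = 0"
      using m' \<open>?min m\<close> by simp
    moreover have "degree (m' - m) \<le> degree m"
      using deg by (metis degree_diff_le order_refl)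
    ultimately show False
      using le \<open>m' \<noteq> m\<close> by (metis antisym eq_iff_diff_eq_0 leading_coeff_0_iff)
  qed
  ultimately have "?min (minimal_poly A)"
    unfolding minimal_poly_def dim by (rule theI)
  then show ?thesis by auto
qed

lemma diag_block_mat_eq_0D:
  assumes "diag_block_mat (map X xs) = 0\<^sub>m (sum_list (map d xs)) (sum_list (map d xs))"
    and "\<And>x. x \<in> set xs \<Longrightarrow> X x \<in> carrier_mat (d x) (d x)" and "x \<in> set xs"
  shows "X x = 0\<^sub>m (d x) (d x)"
  using assms
proof (induction xs)
  case (Cons y ys)
  let ?n = "sum_list (map d ys)"
  let ?D = "diag_block_mat (map X ys)"
  have D: "?D \<in> carrier_mat ?n ?n" using Cons.prems by (intro diag_block_mat_carrier) auto
  have Y: "X y \<in> carrier_mat (d y) (d y)" using Cons.prems by auto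
  have zero: "four_block_mat (X y) (0\<^sub>m (d y) ?n) (0\<^sub>m ?n (d y)) ?D = 0\<^sub>m (d y + ?n) (d y + ?n)"
    using Cons.prems diag_block_mat_Cons[of y ys X d] by auto
  have "X y = 0\<^sub>m (d y) (d y)"
  proof (rule eq_matI)
    fix i j assume "i < dim_row (0\<^sub>m (d y) (d y))" "j < dim_col (0\<^sub>m (d y) (d y))"
    then show "X y $$ (i, j) = 0\<^sub>m (d y) (d y) $$ (i, j)"
      using arg_cong[OF zero, of "\<lambda>M. M $$ (i, j)"] Y D by auto
  qed (use Y in auto)
  moreover have "?D = 0\<^sub>m ?n ?n"
  proof (rule eq_matI)
    fix i j assume "i < dim_row (0\<^sub>m ?n ?n)" "j < dim_col (0\<^sub>m ?n ?n)"
    then show "?D $$ (i, j) = 0\<^sub>m ?n ?n $$ (i, j)"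
      using arg_cong[OF zero, of "\<lambda>M. M $$ (d y + i, d y + j)"] Y D by auto
  qed (use D in auto)
  ultimately show ?case using Cons by auto
qed auto

lemma jordan_matrix_map:
  "jordan_matrix (map (\<lambda>i. (p i, \<mu> i)) xs) = diag_block_mat (map (\<lambda>i. jordan_block (p i) (\<mu> i)) xs)"
  by (simp add: jordan_matrix_def o_def)

text \<open>
  The annihilating polynomials of \<open>A\<close> are those that vanish on every cell; on a single cell the
  condition is divisibility by its characteristic polynomial.
\<close>
lemma poly_mat_similar_jordan_eq_0_iff:
  fixes A :: "'a :: field mat"
  assumes sim: "similar_mat_wit A (jordan_matrix (map (\<lambda>i. (p i, \<mu> i)) xs)) u v"
    and A: "A \<in> carrier_mat n n"
  shows "poly_mat r A = 0\<^sub>m n n \<longleftrightarrow> (\<forall>i\<in>set xs. [:- \<mu> i, 1:] ^ p i dvd r)"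
proof -
  let ?J = "jordan_matrix (map (\<lambda>i. (p i, \<mu> i)) xs)"
  let ?B = "\<lambda>i. jordan_block (p i) (\<mu> i)"
  note w = similar_mat_witD2[OF A sim]
  have n: "sum_list (map p xs) = n"
    using carrier_matD(1)[OF w(5)] by (simp add: o_def)
  have J: "poly_mat r ?J = diag_block_mat (map (\<lambda>i. poly_mat r (?B i)) xs)"
    unfolding jordan_matrix_map by (rule poly_mat_diag_block_mat[where d = p]) auto
  have block: "poly_mat r (?B i) = 0\<^sub>m (p i) (p i) \<longleftrightarrow> [:- \<mu> i, 1:] ^ p i dvd r" for i
    using poly_mat_jordan_block_eq_iff[of r "p i" "\<mu> i" 0]
    by (simp add: linear_power_dvd_iff_coeff poly_mat_0[OF jordan_block_carrier])
  have "poly_mat r A = 0\<^sub>m n n \<longleftrightarrow> poly_mat r ?J = 0\<^sub>m n n"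
  proof
    assume "poly_mat r A = 0\<^sub>m n n"
    then show "poly_mat r ?J = 0\<^sub>m n n"
      unfolding poly_mat_similar[OF similar_mat_wit_sym[OF sim], of r] using w(6,7) by simp
  next
    assume "poly_mat r ?J = 0\<^sub>m n n"
    then show "poly_mat r A = 0\<^sub>m n n"
      unfolding poly_mat_similar[OF sim, of r] using w(6,7) by simp
  qed
  also have "\<dots> \<longleftrightarrow> (\<forall>i\<in>set xs. poly_mat r (?B i) = 0\<^sub>m (p i) (p i))"
  proof
    assume "poly_mat r ?J = 0\<^sub>m n n"
    then show "\<forall>i\<in>set xs. poly_mat r (?B i) = 0\<^sub>m (p i) (p i)"
      using diag_block_mat_eq_0D[of "\<lambda>i. poly_mat r (?B i)" xs p] unfolding J n by auto
  next
    assume "\<forall>i\<in>set xs. poly_mat r (?B i) = 0\<^sub>m (p i) (p i)"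
    then have "map (\<lambda>i. poly_mat r (?B i)) xs = map (\<lambda>i. 0\<^sub>m (p i) (p i)) xs" by auto
    moreover have "diag_block_mat (map (\<lambda>i. 0\<^sub>m (p i) (p i)) xs)
        = (0\<^sub>m (sum_list (map p xs)) (sum_list (map p xs)) :: 'a mat)"
      by (induction xs) (auto simp: Let_def)
    ultimately show "poly_mat r ?J = 0\<^sub>m n n" unfolding J n[symmetric] by (simp only:)
  qed
  also have "\<dots> \<longleftrightarrow> (\<forall>i\<in>set xs. [:- \<mu> i, 1:] ^ p i dvd r)"
    by (simp only: block)
  finally show ?thesis .
qed

text \<open>
  The product of the characteristic polynomials of the cells is a nonzero annihilating polynomial,
  so the minimal polynomial exists. The bound on the orders says that
  interpolation on the spectrum of \<open>A\<close> prescribes enough derivatives for each cell.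
\<close>
lemma order_minimal_poly_jordan:
  assumes sim: "similar_mat_wit A (jordan_matrix (map (\<lambda>i. (p i, \<mu> i)) xs)) u v"
  shows "minimal_poly A \<noteq> 0" and "\<And>i. i \<in> set xs \<Longrightarrow> p i \<le> order (\<mu> i) (minimal_poly A)"
proof -
  obtain n where A: "A \<in> carrier_mat n n"
    using similar_mat_witD(4)[OF refl sim] by blast
  note ann = poly_mat_similar_jordan_eq_0_iff[OF sim A]
  let ?M = "\<Prod>i\<in>set xs. [:- \<mu> i, 1:] ^ p i"
  have "?M \<noteq> 0" by simp
  moreover have "poly_mat ?M A = 0\<^sub>m n n"
    unfolding ann by (auto intro: dvd_prodI)
  ultimately have min: "minimal_poly A \<noteq> 0 \<and> poly_mat (minimal_poly A) A = 0\<^sub>m n n"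
    by (rule minimal_poly_annihilates[OF A])
  show "minimal_poly A \<noteq> 0" using min by simp
  show "p i \<le> order (\<mu> i) (minimal_poly A)" if "i \<in> set xs" for i
    using min that order_divides[of "\<mu> i" "p i" "minimal_poly A"] unfolding ann by auto
qed

text \<open>
  Interpolation makes the choice in the definition of the matrix function succeed, and the orders
  of the minimal polynomial carry the interpolation conditions to every cell.
\<close>
lemma mat_fun_similar_jordan:
  assumes sim: "similar_mat_wit A (jordan_matrix (map (\<lambda>i. (p i, \<mu> i)) xs)) u v"
  obtains r where "mat_fun f A = poly_mat r A"
    and "\<And>i q. i \<in> set xs \<Longrightarrow> q < p i \<Longrightarrow>
      coeff (pcompose r [:\<mu> i, 1:]) q = (deriv ^^ q) f (\<mu> i) / fact q"
proof -
  note min = order_minimal_poly_jordan[OF sim]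
  let ?P = "\<lambda>r. \<forall>z. \<forall>q < order z (minimal_poly A).
    poly ((pderiv ^^ q) r) z = (deriv ^^ q) f z"
  have "\<exists>r. ?P r"
    using hermite_interpolation[OF min(1), of "\<lambda>z q. (deriv ^^ q) f z / fact q"]
    by (simp add: coeff_pcompose_shift)
  then have P: "?P (SOME r. ?P r)" by (rule someI_ex)
  show thesis
  proof (rule that)
    show "mat_fun f A = poly_mat (SOME r. ?P r) A" by (simp add: mat_fun_def)
    fix i q assume "i \<in> set xs" "q < p i"
    then have "q < order (\<mu> i) (minimal_poly A)" using min(2) by fastforce
    then show "coeff (pcompose (SOME r. ?P r) [:\<mu> i, 1:]) q = (deriv ^^ q) f (\<mu> i) / fact q"
      using P by (simp add: coeff_pcompose_shift)
  qed
qed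

text \<open>
  A cell is its own Jordan form, so its matrix function comes from an interpolation polynomial of its
  own; on the cell, that polynomial and \<open>r\<close> agree because they have the same first \<open>m\<close> Taylor
  coefficients.
\<close>
lemma mat_fun_jordan_block:
  assumes "\<And>q. q < m \<Longrightarrow> coeff (pcompose r [:a, 1:]) q = (deriv ^^ q) f a / fact q"
  shows "mat_fun f (jordan_block m a) = poly_mat r (jordan_block m a)"
proof -
  let ?J = "jordan_block m a"
  have "jordan_matrix (map (\<lambda>i. (m, a)) [0::nat]) = ?J"
    by (simp add: jordan_matrix_def del: diag_block_mat.simps)
  then have "similar_mat_wit ?J (jordan_matrix (map (\<lambda>i. (m, a)) [0::nat])) (1\<^sub>m m) (1\<^sub>m m)"
    using similar_mat_wit_refl[of ?J m] by simp
  then obtain t where t: "mat_fun f ?J = poly_mat t ?J"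
    "\<And>i q. i \<in> set [0::nat] \<Longrightarrow> q < m \<Longrightarrow>
      coeff (pcompose t [:a, 1:]) q = (deriv ^^ q) f a / fact q"
    by (rule mat_fun_similar_jordan[where f = f]) blast
  show ?thesis
    unfolding t(1) poly_mat_jordan_block_eq_iff using t(2) assms by simp
qed

section \<open>The truncated root\<close>

lemma fps_power_nth_cong:
  assumes "\<And>q. q < m \<Longrightarrow> fps_nth F q = fps_nth G q" and "q < m"
  shows "fps_nth (F ^ l) q = fps_nth (G ^ l) q"
  using assms(2)
proof (induction l arbitrary: q)
  case (Suc l)
  then show ?case
    unfolding power_Suc fps_mult_nth by (intro sum.cong) (auto simp: assms(1))
qed auto

lemma root_branch_power:
  assumes "l > 0" and "xi0 c ^ l = c"
  shows "root_branch l xi0 c k ^ l = c"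
proof -
  have "exp (2 * of_real pi * \<i> * of_nat k / of_nat l) ^ l
      = exp (of_nat l * (2 * of_real pi * \<i> * of_nat k / of_nat l))"
    by (rule exp_of_nat_mult[symmetric])
  also have "\<dots> = exp (of_nat k * (2 * of_real pi * \<i>))"
    using assms(1) by (simp add: field_simps)
  also have "\<dots> = 1"
    unfolding exp_of_nat_mult by simp
  finally show ?thesis
    using assms(2) by (simp add: root_branch_def power_mult_distrib)
qed

text \<open>
  The full series \<open>F = \<rho> (1 + x/c)\<^bsup>1/l\<^esup>\<close>, where \<open>\<rho>\<^sup>l = c\<close>, satisfies \<open>F\<^sup>l = c (1 + x/c) = c + x\<close> exactly.
  The first \<open>m\<close> coefficients of \<open>F\<^sup>l\<close> depend only on those of \<open>F\<close>, and truncation keeps these.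
\<close>
lemma g_poly_power:
  assumes l: "l > 0" and c: "c \<noteq> 0" and xi0: "xi0 c ^ l = c"
  shows "[:0, 1:] ^ m dvd g_poly l xi0 m c k ^ l - [:c, 1:]"
proof -
  define \<rho> where "\<rho> = root_branch l xi0 c k"
  let ?X = "fps_const (1 / c) * fps_X"
  define F where "F = fps_const \<rho> * (fps_binomial (1 / of_nat l) oo ?X)"
  have "F ^ l = fps_const (\<rho> ^ l) * (fps_binomial (1 / of_nat l) ^ l oo ?X)"
    by (simp add: F_def power_mult_distrib fps_compose_power)
  also have "fps_binomial (1 / of_nat l) ^ l = (1 + fps_X :: complex fps)"
    using l by (simp add: fps_binomial_power fps_binomial_1)
  also have "(1 + fps_X) oo ?X = 1 + ?X"
    by (simp add: fps_compose_add_distrib)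
  also have "\<rho> ^ l = c"
    unfolding \<rho>_def using l xi0 by (rule root_branch_power)
  also have "fps_const c * (1 + ?X) = fps_const c + fps_const c * fps_const (1 / c) * fps_X"
    by (simp only: distrib_left mult.assoc mult_1_right)
  also have "fps_const c * fps_const (1 / c) = 1"
    using c by (simp add: fps_const_mult)
  also have "fps_const c + 1 * fps_X = fps_of_poly [:c, 1:]"
    by (simp add: fps_of_poly_pCons)
  finally have Fl: "F ^ l = fps_of_poly [:c, 1:]" .
  have "coeff (g_poly l xi0 m c k) q = fps_nth F q" if "q < m" for q
    using that c
    by (simp add: g_poly_def F_def fps_compose_linear coeff_sum \<rho>_def power_divide)
  then have "coeff (g_poly l xi0 m c k ^ l) q = coeff [:c, 1:] q" if "q < m" for q
    using fps_power_nth_cong[of m "fps_of_poly (g_poly l xi0 m c k)" F q l] that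
    by (simp add: Fl fps_of_poly_power[symmetric])
  then show ?thesis
    using linear_power_dvd_iff_coeff[of 0 m "g_poly l xi0 m c k ^ l - [:c, 1:]"] by simp
qed

text \<open>
  The substitution of \<open>r - c\<close>, which is divisible by \<open>x - a\<close>, turns the congruence modulo \<open>x\<^sup>m\<close> for the
  truncated root into one modulo \<open>(x - a)\<^sup>m\<close>, and the cell does not see multiples of that power.
\<close>
lemma g_poly_jordan_block:
  fixes m :: nat
  assumes l: "l > 0" and c: "c \<noteq> 0" and xi0: "xi0 c ^ l = c" and r: "poly r a = c"
  defines "J \<equiv> jordan_block m a"
  shows "poly_mat (pcompose (g_poly l xi0 m c k) (r - [:c:])) J ^\<^sub>m l = poly_mat r J"
proof -
  have J: "J \<in> carrier_mat m m" by (simp add: J_def)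
  let ?g = "g_poly l xi0 m c k" and ?h = "r - [:c:]"
  obtain w where w: "?g ^ l - [:c, 1:] = [:0, 1:] ^ m * w"
    using g_poly_power[of l c xi0 m k, OF l c xi0] by (rule dvdE)
  have pow: "pcompose (x ^ i) ?h = pcompose x ?h ^ i" for x i
    by (induction i) (simp_all add: pcompose_mult pcompose_1)
  have "pcompose ?g ?h ^ l - r = pcompose (?g ^ l - [:c, 1:]) ?h"
    by (simp add: pcompose_diff pow pcompose_pCons)
  also have "\<dots> = ?h ^ m * pcompose w ?h"
    by (simp add: w pcompose_mult pow pcompose_pCons)
  finally have eq: "pcompose ?g ?h ^ l - r = ?h ^ m * pcompose w ?h" .
  have "[:- a, 1:] dvd ?h"
    using r by (simp add: poly_eq_0_iff_dvd[symmetric])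
  then have "[:- a, 1:] ^ m dvd pcompose ?g ?h ^ l - r"
    unfolding eq by (simp add: dvd_power_same)
  then have "poly_mat (pcompose ?g ?h ^ l) J = poly_mat r J"
    unfolding linear_power_dvd_iff_coeff J_def poly_mat_jordan_block_eq_iff
    by (simp add: pcompose_diff)
  then show ?thesis by (simp add: poly_mat_power[OF J])
qed

section \<open>Roots of a matrix function\<close>

theorem proposition2p1:
  fixes l n s :: nat
    and A u v :: "complex mat"
    and p k :: "nat \<Rightarrow> nat"
    and \<mu> :: "nat \<Rightarrow> complex"
    and f xi0 :: "complex \<Rightarrow> complex"
    and B :: "nat \<Rightarrow> complex mat"
    and Q :: "complex mat"
  assumes l: "l > 1"
    and A: "A \<in> carrier_mat n n"
    and detA: "det A \<noteq> 0"
    and p: "\<And>i. i < s \<Longrightarrow> p i \<ge> 1"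
    and jordan: "similar_mat_wit A (jordan_matrix (map (\<lambda>i. (p i, \<mu> i)) [0..<s])) u v"
    and f_spectrum: "defined_on_spectrum f A"
    and f_nonzero: "\<And>i. i < s \<Longrightarrow> f (\<mu> i) \<noteq> 0"
    and xi0: "\<And>z. z \<noteq> 0 \<Longrightarrow> xi0 z ^ l = z"
    and k: "\<And>i. i < s \<Longrightarrow> k i < l"
    and B: "\<And>i. i < s \<Longrightarrow>
      B i = poly_mat (g_poly l xi0 (p i) (f (\<mu> i)) (k i))
              (mat_fun f (jordan_block (p i) (\<mu> i)) - f (\<mu> i) \<cdot>\<^sub>m 1\<^sub>m (p i))"
    and Q: "Q = u * diag_block_mat (map B [0..<s]) * v"
  shows "Q ^\<^sub>m l = mat_fun f A \<and> A * Q = Q * A"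
proof -
  let ?xs = "[0..<s]"
  let ?Jm = "jordan_matrix (map (\<lambda>i. (p i, \<mu> i)) ?xs)"
  let ?J = "\<lambda>i. jordan_block (p i) (\<mu> i)"
  let ?D = "diag_block_mat (map B ?xs)"
  obtain r where fA: "mat_fun f A = poly_mat r A"
    and r: "\<And>i q. i \<in> set ?xs \<Longrightarrow> q < p i \<Longrightarrow>
      coeff (pcompose r [:\<mu> i, 1:]) q = (deriv ^^ q) f (\<mu> i) / fact q"
    using mat_fun_similar_jordan[OF jordan, where f = f] by blast
  define b where "b i = pcompose (g_poly l xi0 (p i) (f (\<mu> i)) (k i)) (r - [:f (\<mu> i):])" for i
  have B_eq: "B i = poly_mat (b i) (?J i)" if i: "i < s" for i
  proof -
    have J: "?J i \<in> carrier_mat (p i) (p i)" by simp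
    have "mat_fun f (?J i) = poly_mat r (?J i)"
      using r i by (intro mat_fun_jordan_block) auto
    then show ?thesis
      by (simp add: B[OF i] b_def poly_mat_pcompose[OF J] poly_mat_diff[OF J] poly_mat_const[OF J])
  qed
  \<comment> \<open>The condition \<open>p i \<ge> 1\<close> makes the value of \<open>f\<close> itself one of the interpolated data.\<close>
  have B_pow: "B i ^\<^sub>m l = poly_mat r (?J i)" if i: "i < s" for i
  proof -
    have "poly r (\<mu> i) = f (\<mu> i)"
      using r[of i 0] p[OF i] i by (simp add: coeff_pcompose_shift)
    then show ?thesis
      unfolding B_eq[OF i] b_def using l f_nonzero[OF i] xi0
      by (intro g_poly_jordan_block) auto
  qed
  have B_comm: "?J i * B i = B i * ?J i" if "i < s" for i
    using poly_mat_commute[of "?J i" "p i" "[:0, 1:]" "b i"] that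
    by (simp add: B_eq poly_mat_X[of _ "p i"])
  have B_carrier: "B i \<in> carrier_mat (p i) (p i)" if "i \<in> set ?xs" for i
    using that B_eq by auto
  note w = similar_mat_witD2[OF A jordan]
  have D: "?D \<in> carrier_mat n n"
    using diag_block_mat_carrier[of ?xs B p] B_carrier carrier_matD(1)[OF w(5)] by (simp add: o_def)
  have Q_carrier: "Q \<in> carrier_mat n n" unfolding Q using w(6,7) D by (intro mult_carrier_mat[of _ n n]) auto
  have QD: "similar_mat_wit Q ?D u v"
    using w(1,2,6,7) D Q Q_carrier by (intro similar_mat_witI) auto
  have "?D ^\<^sub>m l = diag_block_mat (map (\<lambda>X. X ^\<^sub>m l) (map B ?xs))"
    using B_carrier by (intro diag_block_pow_mat) fastforce
  also have "\<dots> = diag_block_mat (map (\<lambda>i. poly_mat r (?J i)) ?xs)"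
    using B_pow by (intro arg_cong[of _ _ diag_block_mat]) auto
  also have "\<dots> = poly_mat r ?Jm"
    unfolding jordan_matrix_map by (rule poly_mat_diag_block_mat[where d = p, symmetric]) auto
  finally have D_pow: "?D ^\<^sub>m l = poly_mat r ?Jm" .
  have "?Jm * ?D = diag_block_mat (map (\<lambda>i. ?J i * B i) ?xs)"
    unfolding jordan_matrix_map using B_carrier by (intro diag_block_mat_mult[where d = p]) auto
  also have "\<dots> = diag_block_mat (map (\<lambda>i. B i * ?J i) ?xs)"
    using B_comm by (intro arg_cong[of _ _ diag_block_mat]) auto
  also have "\<dots> = ?D * ?Jm"
    unfolding jordan_matrix_map using B_carrier
    by (intro diag_block_mat_mult[where d = p, symmetric]) auto
  finally have D_comm: "?Jm * ?D = ?D * ?Jm" .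
  \<comment> \<open>Conjugation with \<open>u\<close> carries the commutation of the block diagonal matrices to \<open>A\<close> and \<open>Q\<close>.\<close>
  have conj: "u * X * v * (u * Y * v) = u * (X * Y) * v"
    if "X \<in> carrier_mat n n" "Y \<in> carrier_mat n n" for X Y
  proof -
    note [simp] = w(6,7) that mult_carrier_mat[of _ n n _ n]
    have "u * X * v * (u * Y * v) = u * X * (v * u) * Y * v"
      by (simp add: assoc_mult_mat[of _ n n _ n _ n])
    then show ?thesis
      by (simp add: w(2) left_mult_one_mat[of _ n n] assoc_mult_mat[of _ n n _ n _ n])
  qed
  have "Q ^\<^sub>m l = mat_fun f A"
    unfolding similar_mat_wit_pow_id[OF QD] D_pow fA by (rule poly_mat_similar[OF jordan, symmetric])
  moreover have "A * Q = Q * A"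
    using conj[OF w(5) D] conj[OF D w(5)] D_comm unfolding w(3)[symmetric] Q[symmetric] by simp
  ultimately show ?thesis ..
qed

end
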